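(* For a countably infinite connected graph $G$, the following are equivalent: $G$ is HE-homogeneous; $G$ is ME-homogeneous; $G$ is MB-homogeneous.
   Context: All graphs are undirected and loopless; subgraphs are induced. A homomorphism maps adjacent vertices to adjacent vertices; a monomorphism is an injective homomorphism; a bimorphism of $G$ is a bijective endomorphism $G\to G$. A countable graph $G$ is HE-homogeneous (resp. ME-homogeneous) if every homomorphism (resp. monomorphism) between finite induced subgraphs of $G$ is the restriction of a surjective endomorphism of $G$; it is MB-homogeneous if every monomorphism between finite induced subgraphs of $G$ is the restriction of a bimorphism of $G$. *)

theory Defs
  imports "HOL-Library.Countable_Set"
begin

definition graph :: "'a set \<Rightarrow> ('a \<Rightarrow> 'a \<Rightarrow> bool) \<Rightarrow> bool" where
  "graph V E \<longleftrightarrow> (\<forall>x y. E x y \<longrightarrow> x \<in> V \<and> y \<in> V) \<and>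
     (\<forall>x y. E x y \<longrightarrow> E y x) \<and> (\<forall>x. \<not> E x x)"

definition connected_graph :: "'a set \<Rightarrow> ('a \<Rightarrow> 'a \<Rightarrow> bool) \<Rightarrow> bool" where
  "connected_graph V E \<longleftrightarrow> (\<forall>x\<in>V. \<forall>y\<in>V. E\<^sup>*\<^sup>* x y)"

definition hom_between :: "('a \<Rightarrow> 'a \<Rightarrow> bool) \<Rightarrow> 'a set \<Rightarrow> 'a set \<Rightarrow> ('a \<Rightarrow> 'a) \<Rightarrow> bool" where
  "hom_between E A B f \<longleftrightarrow> f ` A \<subseteq> B \<and> (\<forall>x\<in>A. \<forall>y\<in>A. E x y \<longrightarrow> E (f x) (f y))"

definition mono_between :: "('a \<Rightarrow> 'a \<Rightarrow> bool) \<Rightarrow> 'a set \<Rightarrow> 'a set \<Rightarrow> ('a \<Rightarrow> 'a) \<Rightarrow> bool" where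
  "mono_between E A B f \<longleftrightarrow> hom_between E A B f \<and> inj_on f A"

definition endomorphism :: "'a set \<Rightarrow> ('a \<Rightarrow> 'a \<Rightarrow> bool) \<Rightarrow> ('a \<Rightarrow> 'a) \<Rightarrow> bool" where
  "endomorphism V E g \<longleftrightarrow> hom_between E V V g"

definition surj_endomorphism :: "'a set \<Rightarrow> ('a \<Rightarrow> 'a \<Rightarrow> bool) \<Rightarrow> ('a \<Rightarrow> 'a) \<Rightarrow> bool" where
  "surj_endomorphism V E g \<longleftrightarrow> endomorphism V E g \<and> g ` V = V"

definition bimorphism :: "'a set \<Rightarrow> ('a \<Rightarrow> 'a \<Rightarrow> bool) \<Rightarrow> ('a \<Rightarrow> 'a) \<Rightarrow> bool" where
  "bimorphism V E g \<longleftrightarrow> endomorphism V E g \<and> bij_betw g V V"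

definition HE_homogeneous :: "'a set \<Rightarrow> ('a \<Rightarrow> 'a \<Rightarrow> bool) \<Rightarrow> bool" where
  "HE_homogeneous V E \<longleftrightarrow> (\<forall>A B f. A \<subseteq> V \<and> B \<subseteq> V \<and> finite A \<and> finite B \<and> hom_between E A B f
     \<longrightarrow> (\<exists>g. surj_endomorphism V E g \<and> (\<forall>x\<in>A. g x = f x)))"

definition ME_homogeneous :: "'a set \<Rightarrow> ('a \<Rightarrow> 'a \<Rightarrow> bool) \<Rightarrow> bool" where
  "ME_homogeneous V E \<longleftrightarrow> (\<forall>A B f. A \<subseteq> V \<and> B \<subseteq> V \<and> finite A \<and> finite B \<and> mono_between E A B f
     \<longrightarrow> (\<exists>g. surj_endomorphism V E g \<and> (\<forall>x\<in>A. g x = f x)))"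

definition MB_homogeneous :: "'a set \<Rightarrow> ('a \<Rightarrow> 'a \<Rightarrow> bool) \<Rightarrow> bool" where
  "MB_homogeneous V E \<longleftrightarrow> (\<forall>A B f. A \<subseteq> V \<and> B \<subseteq> V \<and> finite A \<and> finite B \<and> mono_between E A B f
     \<longrightarrow> (\<exists>g. bimorphism V E g \<and> (\<forall>x\<in>A. g x = f x)))"

end

theory Submission
  imports Defs "HOL-Library.Ramsey"
begin

text \<open>Only the implications from ME-homogeneity need an argument. If every finite set of vertices
  has a common neighbour, and every vertex outside the image of a finite homomorphism can be added
  to the image, then back-and-forth extends finite homomorphisms to surjective endomorphisms,
  preserving injectivity. To obtain both properties from ME-homogeneity, observe that non-adjacency
  is preserved by right inverses of surjective endomorphisms; hence in \<open>G\<close> as well as in its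
  complement every finite monomorphism extends to an endomorphism. For a graph with this extension
  property, an induced path on three vertices forces any two vertices to have a common neighbour,
  and if moreover there are arbitrarily large independent sets, then every finite set has a common
  neighbour. If \<open>G\<close> and its complement both contain an induced path on three vertices, Ramsey's
  theorem yields an infinite independent set in one of them; common neighbours then build large
  cliques, which are large independent sets of the other. Otherwise \<open>G\<close>, being connected, is
  complete or complete multipartite, and in the latter case surjectivity forces the parts to be
  infinite.\<close>

section \<open>Common neighbours and extension of finite monomorphisms\<close>

definition common_nbr :: "'a set \<Rightarrow> ('a \<Rightarrow> 'a \<Rightarrow> bool) \<Rightarrow> 'a set \<Rightarrow> bool" where
  "common_nbr V E S \<longleftrightarrow> (\<exists>v\<in>V. \<forall>s\<in>S. E v s)"

definition independent :: "('a \<Rightarrow> 'a \<Rightarrow> bool) \<Rightarrow> 'a set \<Rightarrow> bool" where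
  "independent E S \<longleftrightarrow> (\<forall>x\<in>S. \<forall>y\<in>S. \<not> E x y)"

lemma independent_subset: "independent E S \<Longrightarrow> T \<subseteq> S \<Longrightarrow> independent E T"
  unfolding independent_def by blast

lemma common_nbr_subset: "common_nbr V E S \<Longrightarrow> T \<subseteq> S \<Longrightarrow> common_nbr V E T"
  unfolding common_nbr_def by blast

text \<open>Surjectivity of the extension is not demanded: in this form the property passes from an
  ME-homogeneous graph to its complement.\<close>

locale mh_graph =
  fixes V :: "'a set" and E :: "'a \<Rightarrow> 'a \<Rightarrow> bool"
  assumes graph: "graph V E"
    and extend: "\<lbrakk>finite A; A \<subseteq> V; mono_between E A V f\<rbrakk>
      \<Longrightarrow> \<exists>g. endomorphism V E g \<and> (\<forall>x\<in>A. g x = f x)"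
begin

lemma edge_in: "E x y \<Longrightarrow> x \<in> V" "E x y \<Longrightarrow> y \<in> V"
  and edge_sym: "E x y \<Longrightarrow> E y x"
  and edge_irrefl [simp]: "\<not> E x x"
  using graph unfolding graph_def by blast+

lemma common_nbr_image:
  assumes "finite S" "S \<subseteq> V" "common_nbr V E S" "f ` S \<subseteq> V" "inj_on f S"
    and "\<And>x y. x \<in> S \<Longrightarrow> y \<in> S \<Longrightarrow> E x y \<Longrightarrow> E (f x) (f y)"
  shows "common_nbr V E (f ` S)"
proof -
  have "mono_between E S V f"
    using assms unfolding mono_between_def hom_between_def by blast
  then obtain g where g: "endomorphism V E g" "\<forall>x\<in>S. g x = f x"
    using extend[OF assms(1,2)] by blast
  obtain v where v: "v \<in> V" "\<forall>s\<in>S. E v s"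
    using assms(3) unfolding common_nbr_def by blast
  have "g v \<in> V" using g(1) v(1) unfolding endomorphism_def hom_between_def by blast
  moreover have "E (g v) (f s)" if "s \<in> S" for s
  proof -
    have "E (g v) (g s)"
      using g(1) v that assms(2) unfolding endomorphism_def hom_between_def by blast
    then show ?thesis using g(2) that by simp
  qed
  ultimately show ?thesis unfolding common_nbr_def by blast
qed

text \<open>The vertices of \<open>J\<close> are isolated in \<open>A \<union> J\<close>, so
  \<open>f\<close> together with any bijection from \<open>J\<close> to \<open>R\<close> is a
  monomorphism, whatever edges \<open>R\<close> has within itself or to the image of
  \<open>A\<close>.\<close>

lemma common_nbr_image_Un:
  assumes fin: "finite A" "finite J" and sub: "A \<subseteq> V" "J \<subseteq> V" and disj: "A \<inter> J = {}"
    and cn: "common_nbr V E (A \<union> J)"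
    and nonadj: "\<And>x y. x \<in> J \<Longrightarrow> y \<in> A \<union> J \<Longrightarrow> \<not> E x y"
    and R: "finite R" "card R = card J" "R \<subseteq> V"
    and f: "f ` A \<subseteq> V" "f ` A \<inter> R = {}" "inj_on f A"
      "\<And>x y. x \<in> A \<Longrightarrow> y \<in> A \<Longrightarrow> E x y \<Longrightarrow> E (f x) (f y)"
  shows "common_nbr V E (f ` A \<union> R)"
proof -
  obtain h where h: "bij_betw h J R"
    using finite_same_card_bij[OF fin(2) R(1)] R(2) by metis
  define k where "k x = (if x \<in> J then h x else f x)" for x
  have kA: "k x = f x" if "x \<in> A" for x using that disj unfolding k_def by auto
  have kJ: "k x = h x" if "x \<in> J" for x using that unfolding k_def by auto
  have hJ: "h ` J = R" "inj_on h J" using h unfolding bij_betw_def by auto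
  have imA: "k ` A = f ` A" using kA by (intro image_cong) auto
  have imJ: "k ` J = R" using kJ hJ by (metis image_cong)
  have im: "k ` (A \<union> J) = f ` A \<union> R" using imA imJ by (simp add: image_Un)
  have injA: "inj_on k A" using f(3) kA by (metis inj_on_cong)
  have injJ: "inj_on k J" using hJ kJ by (metis inj_on_cong)
  have "inj_on k (A \<union> J)"
    using injA injJ imA imJ f(2) by (subst inj_on_Un) blast
  moreover have "E (k x) (k y)" if "x \<in> A \<union> J" "y \<in> A \<union> J" "E x y" for x y
  proof -
    have "x \<notin> J" "y \<notin> J" using nonadj that edge_sym by blast+
    then show ?thesis using that f(4) kA by auto
  qed
  ultimately have "common_nbr V E (k ` (A \<union> J))"
    using fin sub cn im R(3) f(1) by (intro common_nbr_image) auto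
  then show ?thesis using im by simp
qed

end

section \<open>Induced stars of bounded size\<close>

text \<open>A hypothetical graph in which \<open>p + 1\<close> is the least size of a vertex set without a common
  neighbour. No independent set of that size has one, since it maps bijectively onto such a
  set.\<close>

locale bounded_star_graph = mh_graph +
  fixes p :: nat
  assumes p_ge_2: "p \<ge> 2"
    and small_common_nbr: "\<lbrakk>finite S; S \<subseteq> V; card S \<le> p\<rbrakk> \<Longrightarrow> common_nbr V E S"
    and no_star: "\<lbrakk>independent E S; S \<subseteq> V; card S = Suc p\<rbrakk> \<Longrightarrow> \<not> common_nbr V E S"
    and large_independent: "\<exists>I. I \<subseteq> V \<and> independent E I \<and> finite I \<and> card I = n"
begin

text \<open>A further neighbour \<open>i\<close> would enlarge \<open>T\<close> to an independent
  set of size \<open>p + 1\<close> with common neighbour \<open>v\<close>. So \<open>p\<close>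
  neighbours of \<open>v\<close> in \<open>I\<close> determine its whole trace on
  \<open>I\<close>.\<close>

lemma star_maximal:
  assumes "independent E I" "I \<subseteq> V" "T \<subseteq> I" "card T = p" "v \<in> V" "\<And>t. t \<in> T \<Longrightarrow> E v t"
    and "i \<in> I" "E v i"
  shows "i \<in> T"
proof (rule ccontr)
  assume "i \<notin> T"
  have "finite T" using assms(4) p_ge_2 by (metis card.infinite not_numeral_le_zero)
  then have "card (insert i T) = Suc p" using \<open>i \<notin> T\<close> assms(4) by simp
  moreover have "independent E (insert i T)"
    using assms(1,3,7) by (auto intro: independent_subset)
  moreover have "common_nbr V E (insert i T)"
    using assms unfolding common_nbr_def by blast
  ultimately show False using no_star assms(2,3,7) by blast
qed

text \<open>Otherwise \<open>insert d J\<close> would be an independent set of size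
  \<open>p + 1\<close> with common neighbour \<open>c\<close>.\<close>

lemma neighbour_meets_star:
  assumes "independent E J" "J \<subseteq> V" "card J = p" "\<And>j. j \<in> J \<Longrightarrow> E c j" "E c d"
  shows "d \<in> J \<or> (\<exists>j\<in>J. E d j)"
proof (rule ccontr)
  assume A: "\<not> ?thesis"
  have "independent E (insert d J)"
    using assms(1) A edge_sym unfolding independent_def by auto
  from star_maximal[OF this _ _ assms(3), of c d] show False
    using A assms edge_in by blast
qed


lemma obtain_star:
  assumes "p \<le> n"
  obtains I J c where "independent E I" "I \<subseteq> V" "finite I" "card I = n"
    "J \<subseteq> I" "finite J" "card J = p" "c \<in> V" "\<And>j. j \<in> J \<Longrightarrow> E c j"
proof -
  obtain I where I: "I \<subseteq> V" "independent E I" "finite I" "card I = n"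
    using large_independent by blast
  obtain J where J: "J \<subseteq> I" "card J = p" "finite J"
    using obtain_subset_with_card_n[of p I] assms I by blast
  obtain c where "c \<in> V" "\<And>j. j \<in> J \<Longrightarrow> E c j"
    using small_common_nbr[of J] J I unfolding common_nbr_def by blast
  then show thesis using that I J by blast
qed

text \<open>A first gain over \<open>small_common_nbr\<close>: the set has \<open>p + 1\<close>
  elements, but contains an edge. By \<open>common_nbr_image_Un\<close> it suffices to find a single
  edge plus \<open>p - 1\<close> isolated vertices with a common neighbour.\<close>

lemma edge_common_nbr:
  assumes uv: "E u v" and R: "R \<subseteq> V" "card R = p - 1" "u \<notin> R" "v \<notin> R"
  shows "common_nbr V E ({u, v} \<union> R)"
proof -
  have finR: "finite R" using R(2) p_ge_2 by (intro card_ge_0_finite) auto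
  obtain I J c where I: "independent E I" "I \<subseteq> V" "finite I" "card I = 2 * p"
    and J: "J \<subseteq> I" "finite J" "card J = p" and c: "c \<in> V" "\<And>j. j \<in> J \<Longrightarrow> E c j"
    using obtain_star[of "2 * p"] by auto
  have "p - 1 \<le> card (I - J)" using I J by (simp add: card_Diff_subset)
  then obtain K where K: "K \<subseteq> I - J" "card K = p - 1" "finite K"
    by (rule obtain_subset_with_card_n)
  have cI: "i \<in> J" if "i \<in> I" "E c i" for i
    using star_maximal[OF I(1,2) J(1,3) c] that by blast
  have cnI: "c \<notin> I"
  proof -
    have "J \<noteq> {}" using J p_ge_2 by auto
    then show ?thesis using I(1) J(1) c(2) unfolding independent_def by blast
  qed
  \<comment> \<open>Being adjacent to \<open>c\<close>, the vertex \<open>d\<close> must see some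
    \<open>j\<close> in the star \<open>J\<close>. Then \<open>d\<close> is a common neighbour of
    the edge \<open>c\<close>, \<open>j\<close> and of \<open>K\<close>, which is isolated since
    \<open>c\<close> has no neighbours in \<open>I\<close> outside \<open>J\<close>.\<close>
  have "card (insert c K) \<le> p" using K cnI p_ge_2 by (simp add: card_insert_if)
  then obtain d where d: "d \<in> V" "E d c" "\<And>k. k \<in> K \<Longrightarrow> E d k"
    using small_common_nbr[of "insert c K"] K I c unfolding common_nbr_def by blast
  have "d \<notin> J"
  proof -
    have "K \<noteq> {}" using K p_ge_2 by auto
    then show ?thesis using d(3) I(1) K(1) J(1) unfolding independent_def by blast
  qed
  then obtain j where j: "j \<in> J" "E d j"
    using neighbour_meets_star[of J c d] I J c d edge_sym independent_subset by blast
  have "c \<noteq> j" using cnI j J by blast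
  define f where "f = (id(c := u, j := v))"
  have f: "f c = u" "f j = v" using \<open>c \<noteq> j\<close> unfolding f_def by auto
  have "u \<noteq> v" using uv by auto
  have "common_nbr V E (f ` {c, j} \<union> R)"
  proof (rule common_nbr_image_Un[where J = K])
    show "{c, j} \<inter> K = {}" using cnI j K by auto
    show "common_nbr V E ({c, j} \<union> K)" using d j unfolding common_nbr_def by blast
    show "\<not> E x y" if "x \<in> K" "y \<in> {c, j} \<union> K" for x y
      using that cI edge_sym K I(1) J(1) j unfolding independent_def by blast
    show "E (f x) (f y)" if "x \<in> {c, j}" "y \<in> {c, j}" "E x y" for x y
      using that f uv edge_sym[OF uv] by auto
  qed (use f \<open>u \<noteq> v\<close> K I J j c R finR uv edge_in in \<open>auto simp: inj_on_def\<close>)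
  then show ?thesis using f by simp
qed

text \<open>Both sets have \<open>p + 2\<close> elements. By \<open>edge_common_nbr\<close> there
  are neighbours \<open>d1\<close>, \<open>d2\<close>, \<open>e\<close> of \<open>c\<close> with
  traces \<open>insert j K\<close>, \<open>insert j L\<close>, \<open>insert j' K\<close> on
  \<open>I\<close>. Then \<open>c\<close> is a common neighbour of the triangle \<open>j\<close>,
  \<open>d1\<close>, \<open>d2\<close> and of the two edges \<open>j\<close>, \<open>d2\<close> and
  \<open>j'\<close>, \<open>e\<close>, in each case along with the remaining, isolated vertices of
  \<open>J\<close>.\<close>

lemma triangle_and_two_edges_common_nbr:
  shows "\<lbrakk>E u v; E v w; E u w; R \<subseteq> V; card R = p - 1; {u, v, w} \<inter> R = {}\<rbrakk>
      \<Longrightarrow> common_nbr V E ({u, v, w} \<union> R)"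
    and "\<lbrakk>E u v; E u' v'; distinct [u, v, u', v']; R \<subseteq> V; finite R; card R = p - 2;
        {u, v, u', v'} \<inter> R = {}\<rbrakk> \<Longrightarrow> common_nbr V E ({u, v, u', v'} \<union> R)"
proof -
  obtain I J c where I: "independent E I" "I \<subseteq> V" "finite I" "card I = 3 * p"
    and J: "J \<subseteq> I" "finite J" "card J = p" and c: "c \<in> V" "\<And>j. j \<in> J \<Longrightarrow> E c j"
    using obtain_star[of "3 * p"] by auto
  have "p - 1 \<le> card (I - J)" using I J by (simp add: card_Diff_subset)
  then obtain K where K: "K \<subseteq> I - J" "card K = p - 1" "finite K"
    by (rule obtain_subset_with_card_n)
  have "p - 1 \<le> card (I - J - K)" using I J K p_ge_2 by (simp add: card_Diff_subset)
  then obtain L where L: "L \<subseteq> I - J - K" "card L = p - 1" "finite L"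
    by (rule obtain_subset_with_card_n)
  have nonadj: "\<not> E x y" if "x \<in> I" "y \<in> I" for x y
    using that I(1) unfolding independent_def by blast
  have ne: "J \<noteq> {}" "K \<noteq> {}" "L \<noteq> {}" using J K L p_ge_2 by auto
  have cnI: "c \<notin> I" using ne J c nonadj by blast
  obtain j j' where j: "j \<in> J" "j' \<in> J" "j \<noteq> j'"
  proof -
    obtain T where "T \<subseteq> J" "card T = 2"
      using obtain_subset_with_card_n[of 2 J] J p_ge_2 by metis
    then show thesis using that by (auto simp: card_2_iff)
  qed
  have ex: "\<exists>d\<in>V. E d c \<and> E d i \<and> (\<forall>k\<in>M. E d k)"
    if "i \<in> J" "M \<subseteq> I - J" "card M = p - 1" for i M
  proof -
    have "common_nbr V E ({c, i} \<union> M)"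
      using that c I J cnI by (intro edge_common_nbr) auto
    then show ?thesis unfolding common_nbr_def by blast
  qed
  obtain d1 where d1: "d1 \<in> V" "E d1 c" "E d1 j" "\<And>k. k \<in> K \<Longrightarrow> E d1 k"
    using ex[of j K] j K by blast
  obtain d2 where d2: "d2 \<in> V" "E d2 c" "E d2 j" "\<And>k. k \<in> L \<Longrightarrow> E d2 k"
    using ex[of j L] j L by blast
  obtain e where e: "e \<in> V" "E e c" "E e j'" "\<And>k. k \<in> K \<Longrightarrow> E e k"
    using ex[of j' K] j K by blast
  have trace: "i \<in> insert a M"
    if "a \<in> J" "M \<subseteq> I - J" "card M = p - 1" "d \<in> V" "E d a" "\<And>k. k \<in> M \<Longrightarrow> E d k"
      "i \<in> I" "E d i" for a M d i
  proof (rule star_maximal[OF I(1,2)])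
    have "finite M" using that(2) I(3) by (meson finite_Diff finite_subset)
    then show "card (insert a M) = p" using that p_ge_2 by (auto simp: card_insert_if)
  qed (use that J in auto)
  have t1: "i \<in> insert j K" if "i \<in> I" "E d1 i" for i
    using trace[of j K d1 i] d1 j K that by blast
  have t2: "i \<in> insert j L" if "i \<in> I" "E d2 i" for i
    using trace[of j L d2 i] d2 j L that by blast
  have te: "i \<in> insert j' K" if "i \<in> I" "E e i" for i
    using trace[of j' K e i] e j K that by blast
  have dI: "d1 \<notin> I" "d2 \<notin> I" "e \<notin> I" using d1(3) d2(3) e(3) j J nonadj by blast+
  have "d1 \<noteq> d2" using t1 d2(4) ne L K J j by blast
  have "d2 \<noteq> e" using te d2(4) ne L K J j by blast
  \<comment> \<open>Otherwise \<open>d1\<close>, \<open>d2\<close> and \<open>J - {j}\<close> would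
    be \<open>p + 1\<close> independent neighbours of \<open>c\<close>.\<close>
  have dd: "E d1 d2"
  proof (rule ccontr)
    assume nE: "\<not> E d1 d2"
    have J': "card (J - {j}) = p - 1" using J j by simp
    have ni: "\<not> E d1 x" "\<not> E d2 x" if "x \<in> J - {j}" for x
      using t1[of x] t2[of x] that J K L by blast+
    have "independent E ({d1, d2} \<union> (J - {j}))"
      using nE ni nonadj J edge_sym edge_irrefl unfolding independent_def by blast
    moreover have "card ({d1, d2} \<union> (J - {j})) = Suc p"
      using J' dI J \<open>d1 \<noteq> d2\<close> p_ge_2 by (auto simp: card_insert_if)
    moreover have "common_nbr V E ({d1, d2} \<union> (J - {j}))"
      using c d1 d2 edge_sym unfolding common_nbr_def by blast
    ultimately show False using no_star d1 d2 J I by blast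
  qed
  \<comment> \<open>As a neighbour of \<open>e\<close>, \<open>d2\<close> would have to see a vertex
    of the star \<open>insert j' K\<close>, which is disjoint from the trace
    \<open>insert j L\<close> of \<open>d2\<close>.\<close>
  have nde: "\<not> E d2 e"
  proof
    assume "E d2 e"
    have "card (insert j' K) = p" using K j p_ge_2 by (auto simp: card_insert_if)
    moreover have "independent E (insert j' K)" "insert j' K \<subseteq> V"
      using independent_subset[OF I(1), of "insert j' K"] I(2) J(1) K(1) j(2) by auto
    moreover have "E e i" if "i \<in> insert j' K" for i using that e by blast
    ultimately have "d2 \<in> insert j' K \<or> (\<exists>k\<in>insert j' K. E d2 k)"
      using edge_sym[OF \<open>E d2 e\<close>] by (intro neighbour_meets_star[of _ e])
    then show False using t2 dI J K L j by blast
  qed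
  show "common_nbr V E ({u, v, w} \<union> R)"
    if "E u v" "E v w" "E u w" "R \<subseteq> V" "card R = p - 1" "{u, v, w} \<inter> R = {}"
  proof -
    have finR: "finite R" using that p_ge_2 by (intro card_ge_0_finite) auto
    define f where "f = (id(j := u, d1 := v, d2 := w))"
    have f: "f j = u" "f d1 = v" "f d2 = w"
      using \<open>d1 \<noteq> d2\<close> dI j J unfolding f_def by auto
    have ne': "u \<noteq> v" "v \<noteq> w" "u \<noteq> w" using that by auto
    have "common_nbr V E (f ` {j, d1, d2} \<union> R)"
    proof (rule common_nbr_image_Un[where J = "J - {j}"])
      show "common_nbr V E ({j, d1, d2} \<union> (J - {j}))"
        using c d1 d2 j edge_sym unfolding common_nbr_def by blast
      show "\<not> E x y" if "x \<in> J - {j}" "y \<in> {j, d1, d2} \<union> (J - {j})" for x y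
        using that t1[of x] t2[of x] nonadj[of x y] edge_sym[of x y] j J K L by blast
      show "E (f x) (f y)" if xy: "x \<in> {j, d1, d2}" "y \<in> {j, d1, d2}" "E x y" for x y
        using xy f \<open>E u v\<close> \<open>E v w\<close> \<open>E u w\<close>
          edge_sym[OF \<open>E u v\<close>] edge_sym[OF \<open>E v w\<close>] edge_sym[OF \<open>E u w\<close>] by auto
      show "{j, d1, d2} \<inter> (J - {j}) = {}" using dI J by auto
    qed (use f ne' I J j d1 d2 that finR edge_in in \<open>auto simp: inj_on_def\<close>)
    then show ?thesis using f by simp
  qed
  show "common_nbr V E ({u, v, u', v'} \<union> R)"
    if "E u v" "E u' v'" "distinct [u, v, u', v']" "R \<subseteq> V" "finite R" "card R = p - 2"
      "{u, v, u', v'} \<inter> R = {}"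
  proof -
    \<comment> \<open>No edge joins \<open>{j, d2}\<close> to \<open>{j', e}\<close>, so edges are
      preserved whatever happens between \<open>{u, v}\<close> and \<open>{u', v'}\<close>.\<close>
    define f where "f = (id(j := u, d2 := v, j' := u', e := v'))"
    have f: "f j = u" "f d2 = v" "f j' = u'" "f e = v'"
      using \<open>d2 \<noteq> e\<close> dI j J unfolding f_def by auto
    have "common_nbr V E (f ` {j, d2, j', e} \<union> R)"
    proof (rule common_nbr_image_Un[where J = "J - {j, j'}"])
      show "common_nbr V E ({j, d2, j', e} \<union> (J - {j, j'}))"
        using c e d2 j edge_sym unfolding common_nbr_def by blast
      show "\<not> E x y" if "x \<in> J - {j, j'}" "y \<in> {j, d2, j', e} \<union> (J - {j, j'})" for x y
        using that te[of x] t2[of x] nonadj[of x y] edge_sym[of x y] j J K L by blast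
      show "E (f x) (f y)" if xy: "x \<in> {j, d2, j', e}" "y \<in> {j, d2, j', e}" "E x y" for x y
      proof -
        have "\<not> E j j'" "\<not> E j' j" "\<not> E j e" "\<not> E e j" "\<not> E d2 j'" "\<not> E j' d2" "\<not> E d2 e" "\<not> E e d2"
          using nonadj te[of j] t2[of j'] nde j J K L edge_sym by blast+
        then show ?thesis using xy f \<open>E u v\<close> \<open>E u' v'\<close>
          edge_sym[OF \<open>E u v\<close>] edge_sym[OF \<open>E u' v'\<close>] by auto
      qed
      show "{j, d2, j', e} \<inter> (J - {j, j'}) = {}" using dI J by auto
      show "card R = card (J - {j, j'})" using J j that by (simp add: card_Diff_subset)
    qed (use f I J j e d2 that edge_in in \<open>auto simp: inj_on_def\<close>)
    then show ?thesis using f by simp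
  qed
qed

text \<open>The pairwise adjacent vertices \<open>c\<close>, \<open>d\<close>, \<open>y\<close> have in \<open>I\<close> the neighbourhoods \<open>J\<close>, \<open>K \<union> {j}\<close>,
  \<open>L \<union> {j', k}\<close>, which pairwise meet but have no common point. A common neighbour \<open>w\<close> of \<open>c\<close>, \<open>d\<close>, \<open>y\<close>
  must have a neighbour in each of them, but being adjacent to \<open>M\<close> as well it has only one
  further neighbour in \<open>I\<close>.\<close>

lemma inconsistent: False
proof -
  obtain I J c where I: "independent E I" "I \<subseteq> V" "finite I" "card I = 5 * p"
    and J: "J \<subseteq> I" "finite J" "card J = p" and c: "c \<in> V" "\<And>j. j \<in> J \<Longrightarrow> E c j"
    using obtain_star[of "5 * p"] by auto
  have "p - 1 \<le> card (I - J)" using I J by (simp add: card_Diff_subset)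
  then obtain K where K: "K \<subseteq> I - J" "card K = p - 1" "finite K"
    by (rule obtain_subset_with_card_n)
  have "p - 2 \<le> card (I - J - K)" using I J K p_ge_2 by (simp add: card_Diff_subset)
  then obtain L where L: "L \<subseteq> I - J - K" "card L = p - 2" "finite L"
    by (rule obtain_subset_with_card_n)
  have "p - 1 \<le> card (I - J - K - L)" using I J K L p_ge_2 by (simp add: card_Diff_subset)
  then obtain M where M: "M \<subseteq> I - J - K - L" "card M = p - 1" "finite M"
    by (rule obtain_subset_with_card_n)
  have nonadj: "\<not> E x y" if "x \<in> I" "y \<in> I" for x y
    using that I(1) unfolding independent_def by blast
  have ne: "J \<noteq> {}" "K \<noteq> {}" "M \<noteq> {}" using J K M p_ge_2 by auto
  have cnI: "c \<notin> I" using ne J c nonadj by blast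
  obtain j j' where j: "j \<in> J" "j' \<in> J" "j \<noteq> j'"
  proof -
    obtain T where "T \<subseteq> J" "card T = 2"
      using obtain_subset_with_card_n[of 2 J] J p_ge_2 by metis
    then show thesis using that by (auto simp: card_2_iff)
  qed
  obtain k where k: "k \<in> K" using ne by blast
  have "common_nbr V E ({c, j} \<union> K)"
    using c I J K j cnI by (intro edge_common_nbr) auto
  then obtain d where d: "d \<in> V" "E d c" "E d j" "\<And>k. k \<in> K \<Longrightarrow> E d k"
    unfolding common_nbr_def by blast
  have dI: "d \<notin> I" using d(3) j J nonadj by blast
  have "c \<noteq> d" using d by auto
  \<comment> \<open>The two disjoint edges are \<open>c\<close>, \<open>j'\<close> and
    \<open>d\<close>, \<open>k\<close>. With the \<open>p - 2\<close> vertices of \<open>L\<close>,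
    this gives \<open>y\<close> exactly \<open>p\<close> prescribed neighbours in
    \<open>I\<close>.\<close>
  have "common_nbr V E ({c, j', d, k} \<union> L)"
    using c d j k I J K L dI cnI \<open>c \<noteq> d\<close>
    by (intro triangle_and_two_edges_common_nbr(2)) auto
  then obtain y where y: "y \<in> V" "E y c" "E y j'" "E y d" "E y k" "\<And>l. l \<in> L \<Longrightarrow> E y l"
    unfolding common_nbr_def by blast
  have yI: "y \<notin> I" using y(3) j J nonadj by blast
  have "common_nbr V E ({c, d, y} \<union> M)"
    using c d y I J K L M dI cnI yI edge_sym
    by (intro triangle_and_two_edges_common_nbr(1)) auto
  then obtain w where w: "w \<in> V" "E w c" "E w d" "E w y" "\<And>l. l \<in> M \<Longrightarrow> E w l"
    unfolding common_nbr_def by blast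
  have wI: "w \<notin> I" using w(5) ne M nonadj by blast
  have meets: "\<exists>s\<in>S. E w s"
    if "S \<subseteq> I" "card S = p" "\<And>s. s \<in> S \<Longrightarrow> E x s" "E w x" for x S
    using neighbour_meets_star[of S x w] that I wI edge_sym independent_subset by blast
  obtain a where a: "a \<in> J" "E w a" using meets[of J c] J c w by blast
  have "card (insert a M) = p" using M a p_ge_2 by (auto simp: card_insert_if)
  then have tw: "i \<in> insert a M" if "i \<in> I" "E w i" for i
    using star_maximal[OF I(1,2), of "insert a M" w i] that a J M w by auto
  have "card (insert j K) = p" using K j p_ge_2 by (auto simp: card_insert_if)
  then obtain b where b: "b \<in> insert j K" "E w b"
    using meets[of "insert j K" d] J K j d w by blast
  \<comment> \<open>Outside \<open>M\<close>, \<open>w\<close> has only the neighbour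
    \<open>a\<close> in \<open>I\<close>; it lies in both \<open>J\<close> and
    \<open>insert j K\<close>, which share just \<open>j\<close>.\<close>
  then have "a = j" using tw[of b] J K M j a by blast
  have "card (insert j' (insert k L)) = p"
    using L K k j p_ge_2 J by (auto simp: card_insert_if)
  then obtain b' where "b' \<in> insert j' (insert k L)" "E w b'"
    using meets[of "insert j' (insert k L)" y] J K L j k y w by blast
  then show False using tw[of b'] \<open>a = j\<close> J K L M j k by blast
qed

end

text \<open>If \<open>m\<close> is the least size of a counterexample, the graph is a
  \<open>bounded_star_graph\<close> with \<open>p = m - 1\<close>; the hypothesis on pairs gives
  \<open>p \<ge> 2\<close>.\<close>

theorem (in mh_graph) all_common_nbr:
  assumes pairs: "\<And>u v. u \<in> V \<Longrightarrow> v \<in> V \<Longrightarrow> common_nbr V E {u, v}"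
    and large: "\<And>n. \<exists>I. I \<subseteq> V \<and> independent E I \<and> finite I \<and> card I = n"
    and S: "finite S" "S \<subseteq> V"
  shows "common_nbr V E S"
proof (rule ccontr)
  assume nS: "\<not> common_nbr V E S"
  define P where "P n \<longleftrightarrow> (\<exists>S. finite S \<and> S \<subseteq> V \<and> card S = n \<and> \<not> common_nbr V E S)" for n
  define m where "m = (LEAST n. P n)"
  have "P (card S)" using S nS unfolding P_def by blast
  then have "P m" unfolding m_def by (rule LeastI)
  have below: "common_nbr V E T" if "finite T" "T \<subseteq> V" "card T < m" for T
    using not_less_Least[of "card T" P] that unfolding m_def P_def by blast
  obtain B where B: "finite B" "B \<subseteq> V" "card B = m" "\<not> common_nbr V E B"
    using \<open>P m\<close> unfolding P_def by blast
  have "m \<ge> 3"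
  proof (rule ccontr)
    assume "\<not> m \<ge> 3"
    have "V \<noteq> {}" using large[of 1] by auto
    then obtain z where z: "z \<in> V" by blast
    consider "card B = 0" | "card B = 1" | "card B = 2" using B \<open>\<not> m \<ge> 3\<close> by linarith
    then obtain u v where "u \<in> V" "v \<in> V" "B \<subseteq> {u, v}"
    proof cases
      case 1 then show ?thesis using that z B by auto
    next
      case 2 then show ?thesis using that B by (auto simp: card_1_singleton_iff)
    next
      case 3 then show ?thesis using that B by (auto simp: card_2_iff)
    qed
    then show False using pairs B common_nbr_subset by blast
  qed
  interpret bounded_star_graph V E "m - 1"
  proof
    show "\<not> common_nbr V E T" if T: "independent E T" "T \<subseteq> V" "card T = Suc (m - 1)" for T
    proof
      assume cn: "common_nbr V E T"
      have finT: "finite T" using T by (intro card_ge_0_finite) auto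
      have "card B = card T" using T B \<open>m \<ge> 3\<close> by simp
      then have "common_nbr V E (id ` {} \<union> B)"
        using T cn B finT by (intro common_nbr_image_Un[of "{}" T]) (auto simp: independent_def)
      then show False using B by simp
    qed
  qed (use \<open>m \<ge> 3\<close> below large in auto)
  show False by (rule inconsistent)
qed

section \<open>Passage to the complement\<close>

definition complement :: "'a set \<Rightarrow> ('a \<Rightarrow> 'a \<Rightarrow> bool) \<Rightarrow> 'a \<Rightarrow> 'a \<Rightarrow> bool" where
  "complement V E x y \<longleftrightarrow> x \<in> V \<and> y \<in> V \<and> x \<noteq> y \<and> \<not> E x y"

lemma graph_complement: "graph V E \<Longrightarrow> graph V (complement V E)"
  by (auto simp: graph_def complement_def)

lemma complement_complement: "graph V E \<Longrightarrow> complement V (complement V E) = E"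
  by (intro ext) (auto simp: graph_def complement_def)

lemma ME_homogeneous_mono_extends:
  assumes "ME_homogeneous V E" "finite A" "A \<subseteq> V" "mono_between E A V f"
  obtains g where "endomorphism V E g" "g ` V = V" "\<And>x. x \<in> A \<Longrightarrow> g x = f x"
proof -
  have "mono_between E A (f ` A) f" "f ` A \<subseteq> V"
    using assms(4) unfolding mono_between_def hom_between_def by blast+
  then obtain g where "surj_endomorphism V E g" "\<forall>x\<in>A. g x = f x"
    using assms(1-3) unfolding ME_homogeneous_def by (metis finite_imageI)
  then show thesis using that unfolding surj_endomorphism_def by blast
qed

lemma ME_homogeneous_mh_graph:
  assumes "graph V E" "ME_homogeneous V E"
  shows "mh_graph V E"
proof
  show "\<exists>g. endomorphism V E g \<and> (\<forall>x\<in>A. g x = f x)"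
    if "finite A" "A \<subseteq> V" "mono_between E A V f" for A f
    using ME_homogeneous_mono_extends[OF assms(2) that] by metis
qed (rule assms(1))

text \<open>A right inverse of a surjective endomorphism preserves non-adjacency, so surjective
  extensions of the inverse map yield extensions in the complement.\<close>

lemma ME_homogeneous_mh_graph_complement:
  assumes gr: "graph V E" and ME: "ME_homogeneous V E"
  shows "mh_graph V (complement V E)"
proof
  show "graph V (complement V E)" using gr by (rule graph_complement)
  fix A f assume A: "finite A" "A \<subseteq> V" "mono_between (complement V E) A V f"
  then have f: "inj_on f A" "f ` A \<subseteq> V"
    "\<And>x y. x \<in> A \<Longrightarrow> y \<in> A \<Longrightarrow> complement V E x y \<Longrightarrow> complement V E (f x) (f y)"
    unfolding mono_between_def hom_between_def by auto
  \<comment> \<open>An edge between \<open>f x\<close> and \<open>f y\<close> forces one between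
    \<open>x\<close> and \<open>y\<close>, because \<open>f\<close> preserves non-adjacency of
    distinct vertices.\<close>
  have "mono_between E (f ` A) V (inv_into A f)"
    unfolding mono_between_def hom_between_def
  proof (intro conjI ballI impI)
    show "inv_into A f ` f ` A \<subseteq> V" "inj_on (inv_into A f) (f ` A)"
      using A f by (auto simp: inj_on_def)
    fix u v assume uv: "u \<in> f ` A" "v \<in> f ` A" "E u v"
    then obtain x y where xy: "x \<in> A" "y \<in> A" "u = f x" "v = f y" by blast
    have "x \<noteq> y" using uv xy gr by (auto simp: graph_def)
    have "\<not> complement V E (f x) (f y)" using uv xy by (simp add: complement_def)
    then have "\<not> complement V E x y" using f(3)[OF xy(1,2)] by blast
    then have "E x y" using A(2) xy \<open>x \<noteq> y\<close> by (auto simp: complement_def)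
    then show "E (inv_into A f u) (inv_into A f v)" using xy f(1) by simp
  qed
  then obtain g where g: "endomorphism V E g" "g ` V = V"
    "\<And>u. u \<in> f ` A \<Longrightarrow> g u = inv_into A f u"
    using ME_homogeneous_mono_extends[OF ME, of "f ` A" "inv_into A f"] A f by auto
  \<comment> \<open>As \<open>g\<close> sends \<open>f x\<close> back to \<open>x\<close> for
    \<open>x\<close> in \<open>A\<close>, the right inverse \<open>h\<close> of \<open>g\<close> can
    be prescribed to be \<open>f\<close> on \<open>A\<close>.\<close>
  define h where "h x = (if x \<in> A then f x else inv_into V g x)" for x
  have h: "h x \<in> V" "g (h x) = x" if "x \<in> V" for x
    using that f g A inv_into_into[of x g V] f_inv_into_f[of x g V] unfolding h_def by auto
  have "complement V E (h x) (h y)" if "complement V E x y" for x y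
  proof -
    have xy: "x \<in> V" "y \<in> V" "x \<noteq> y" "\<not> E x y" using that unfolding complement_def by auto
    have "\<not> E (h x) (h y)"
      using g(1) h xy unfolding endomorphism_def hom_between_def by metis
    then show ?thesis using h xy unfolding complement_def by metis
  qed
  then have "endomorphism V (complement V E) h"
    using h unfolding endomorphism_def hom_between_def by blast
  then show "\<exists>g. endomorphism V (complement V E) g \<and> (\<forall>x\<in>A. g x = f x)"
    by (intro exI[of _ h]) (simp add: h_def)
qed

section \<open>Common neighbours in the graph and its complement\<close>

text \<open>The ends \<open>x\<close>, \<open>z\<close> of the induced path are non-adjacent with
  common neighbour \<open>y\<close>, so every injection of \<open>{x, z}\<close> into
  \<open>V\<close> is a monomorphism and carries the common neighbour along. For
  \<open>u = v\<close> the single vertex \<open>x\<close> is moved instead.\<close>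

lemma (in mh_graph) common_nbr_pair:
  assumes "E x y" "E y z" "x \<noteq> z" "\<not> E x z" "u \<in> V" "v \<in> V"
  shows "common_nbr V E {u, v}"
proof (cases "u = v")
  case True
  have "common_nbr V E ((\<lambda>_. u) ` {x})"
  proof (rule common_nbr_image)
    show "common_nbr V E {x}"
      using assms(1) edge_in edge_sym unfolding common_nbr_def by blast
  qed (use assms edge_in in auto)
  then show ?thesis using True by simp
next
  case False
  have "common_nbr V E ((id(x := u, z := v)) ` {x, z})"
  proof (rule common_nbr_image)
    show "common_nbr V E {x, z}"
      using assms edge_in edge_sym unfolding common_nbr_def by blast
    show "E ((id(x := u, z := v)) a) ((id(x := u, z := v)) b)"
      if "a \<in> {x, z}" "b \<in> {x, z}" "E a b" for a b
      using that assms edge_sym[of z x] by auto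
  qed (use False assms edge_in in \<open>auto simp: inj_on_def\<close>)
  then show ?thesis using assms(3) by simp
qed

text \<open>Repeatedly adding a common neighbour lets a clique grow to any size. Cliques appear as
  independent sets of the complement, the form in which \<open>all_common_nbr\<close> needs
  them.\<close>

lemma (in mh_graph) common_nbr_clique:
  assumes "\<And>S. finite S \<Longrightarrow> S \<subseteq> V \<Longrightarrow> common_nbr V E S"
  shows "\<exists>K. K \<subseteq> V \<and> independent (complement V E) K \<and> finite K \<and> card K = n"
proof (induction n)
  case 0
  then show ?case by (intro exI[of _ "{}"]) (auto simp: independent_def)
next
  case (Suc n)
  then obtain K where K: "K \<subseteq> V" "independent (complement V E) K" "finite K" "card K = n"
    by blast
  then obtain v where v: "v \<in> V" "\<And>k. k \<in> K \<Longrightarrow> E v k"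
    using assms[of K] unfolding common_nbr_def by blast
  have "v \<notin> K" using v edge_irrefl by blast
  then show ?case
    using K v edge_sym
    by (intro exI[of _ "insert v K"]) (auto simp: independent_def complement_def)
qed

text \<open>Two rounds of \<open>all_common_nbr\<close>: finite subsets of \<open>Y\<close> settle
  \<open>E\<close>, and the cliques that this produces are the independent sets needed in the
  complement.\<close>

lemma common_nbr_of_infinite_independent:
  assumes mh: "mh_graph V E" "mh_graph V (complement V E)"
    and pairs: "\<And>u v. u \<in> V \<Longrightarrow> v \<in> V \<Longrightarrow> common_nbr V E {u, v}"
      "\<And>u v. u \<in> V \<Longrightarrow> v \<in> V \<Longrightarrow> common_nbr V (complement V E) {u, v}"
    and Y: "infinite Y" "Y \<subseteq> V" "independent E Y"
    and S: "finite S" "S \<subseteq> V"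
  shows "common_nbr V E S" "common_nbr V (complement V E) S"
proof -
  have "\<exists>I. I \<subseteq> V \<and> independent E I \<and> finite I \<and> card I = n" for n
  proof -
    obtain I where "finite I" "card I = n" "I \<subseteq> Y"
      using infinite_arbitrarily_large[OF Y(1), of n] by blast
    then show ?thesis using Y independent_subset by blast
  qed
  then have cn: "common_nbr V E T" if "finite T" "T \<subseteq> V" for T
    using mh_graph.all_common_nbr[OF mh(1) pairs(1)] that by blast
  then show "common_nbr V E S" using S by blast
  have "\<exists>I. I \<subseteq> V \<and> independent (complement V E) I \<and> finite I \<and> card I = n" for n
    using mh_graph.common_nbr_clique[OF mh(1)] cn by blast
  then show "common_nbr V (complement V E) S"
    using mh_graph.all_common_nbr[OF mh(2) pairs(2)] S by blast
qed

lemma common_nbr_both: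
  assumes mh: "mh_graph V E" "mh_graph V (complement V E)" and inf: "infinite V"
    and pairs: "\<And>u v. u \<in> V \<Longrightarrow> v \<in> V \<Longrightarrow> common_nbr V E {u, v}"
      "\<And>u v. u \<in> V \<Longrightarrow> v \<in> V \<Longrightarrow> common_nbr V (complement V E) {u, v}"
    and S: "finite S" "S \<subseteq> V"
  shows "common_nbr V E S" "common_nbr V (complement V E) S"
proof -
  have gr: "graph V E" using mh(1) by (rule mh_graph.graph)
  \<comment> \<open>On pairs of distinct vertices, colour 1 marks the non-edges. A homogeneous set
    of the other colour is independent in the complement, and the hypotheses are symmetric in the
    two graphs.\<close>
  define c :: "'a set \<Rightarrow> nat" where "c X = (if independent E X then 1 else 0)" for X
  obtain Y t where Y: "Y \<subseteq> V" "infinite Y" "\<forall>x\<in>Y. \<forall>y\<in>Y. x \<noteq> y \<longrightarrow> c {x, y} = t"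
  proof -
    have "\<forall>x\<in>V. \<forall>y\<in>V. x \<noteq> y \<longrightarrow> c {x, y} < 2" unfolding c_def by simp
    from Ramsey2[OF inf this] show thesis using that by blast
  qed
  have "common_nbr V E S \<and> common_nbr V (complement V E) S"
  proof (cases "t = 1")
    case True
    have "\<not> E x y" if "x \<in> Y" "y \<in> Y" for x y
    proof (cases "x = y")
      case True
      then show ?thesis using gr unfolding graph_def by blast
    next
      case False
      then have "c {x, y} = 1" using Y(3) that \<open>t = 1\<close> by blast
      then show ?thesis unfolding c_def independent_def by (auto split: if_splits)
    qed
    then have "independent E Y" unfolding independent_def by blast
    then show ?thesis using common_nbr_of_infinite_independent[OF mh pairs Y(2,1)] S by blast
  next
    case False
    have "E x y" if "x \<in> Y" "y \<in> Y" "x \<noteq> y" for x y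
    proof -
      have "\<not> independent E {x, y}" using Y that False unfolding c_def by metis
      then show ?thesis using gr unfolding independent_def graph_def by blast
    qed
    then have "independent (complement V E) Y"
      unfolding independent_def complement_def by blast
    then show ?thesis
      using common_nbr_of_infinite_independent[of V "complement V E" Y S]
        mh pairs Y S by (simp add: complement_complement[OF gr])
  qed
  then show "common_nbr V E S" "common_nbr V (complement V E) S" by auto
qed

section \<open>Complete multipartite graphs and the back step\<close>

text \<open>Fixing \<open>x\<close> and moving \<open>x'\<close> to \<open>z\<close> extends to a
  surjective \<open>g\<close>. Preimages of non-neighbours of \<open>x\<close> are non-neighbours of
  \<open>x\<close>, so the image of \<open>?C\<close> covers \<open>?C\<close> and also
  \<open>z\<close>, which is impossible for finite \<open>?C\<close>.\<close>

lemma ME_homogeneous_infinite_nonneighbours: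
  assumes gr: "graph V E" and ME: "ME_homogeneous V E"
    and x: "x \<in> V" "x' \<in> V" "x' \<noteq> x" "\<not> E x x'" "E x z"
  shows "infinite {y \<in> V. \<not> E x y}"
proof
  let ?C = "{y \<in> V. \<not> E x y}"
  assume fin: "finite ?C"
  have E: "z \<in> V" "z \<noteq> x" "\<not> E x x" "\<not> E x' x'" "\<not> E x' x" "\<And>u v. E u v \<Longrightarrow> E v u"
    using gr x unfolding graph_def by blast+
  have "mono_between E {x, x'} V (id(x' := z))"
    using x E unfolding mono_between_def hom_between_def by (auto simp: inj_on_def)
  then obtain g where g: "endomorphism V E g" "g ` V = V"
    "\<And>u. u \<in> {x, x'} \<Longrightarrow> g u = (id(x' := z)) u"
    using ME_homogeneous_mono_extends[OF ME, of "{x, x'}" "id(x' := z)"] x by auto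
  have gx: "g x = x" "g x' = z" using g(3)[of x] g(3)[of x'] x(3) by auto
  have "insert z ?C \<subseteq> g ` ?C"
  proof
    fix y assume "y \<in> insert z ?C"
    then consider "y = z" | "y \<in> V" "\<not> E x y" by blast
    then show "y \<in> g ` ?C"
    proof cases
      case 1
      then show ?thesis using gx x by auto
    next
      case 2
      then obtain u where u: "u \<in> V" "g u = y" using g(2) by (metis imageE)
      then have "\<not> E x u"
        using g(1) gx x 2 unfolding endomorphism_def hom_between_def by metis
      then show ?thesis using u by blast
    qed
  qed
  then have "card (insert z ?C) \<le> card ?C"
    using fin by (meson card_image_le card_mono finite_imageI le_trans)
  then show False using fin x(5) by simp
qed

text \<open>The back step for homomorphisms: a new vertex \<open>x\<close> that can be sent to the
  missing value \<open>y\<close> without breaking edges.\<close>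

definition back_property :: "'a set \<Rightarrow> ('a \<Rightarrow> 'a \<Rightarrow> bool) \<Rightarrow> bool" where
  "back_property V E \<longleftrightarrow> (\<forall>A f y. finite A \<and> A \<subseteq> V \<and> hom_between E A V f \<and> y \<in> V \<and> y \<notin> f ` A
     \<longrightarrow> (\<exists>x\<in>V - A. \<forall>a\<in>A. E x a \<longrightarrow> E y (f a)))"

text \<open>A vertex non-adjacent to all of \<open>A\<close> leaves no edge to preserve.\<close>

lemma common_nbr_complement_back_property:
  assumes "\<And>S. finite S \<Longrightarrow> S \<subseteq> V \<Longrightarrow> common_nbr V (complement V E) S"
  shows "back_property V E"
  unfolding back_property_def
proof (intro allI impI, elim conjE)
  fix A f y assume "finite A" "A \<subseteq> V"
  then obtain x where "x \<in> V" "\<forall>a\<in>A. complement V E x a"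
    using assms[of A] unfolding common_nbr_def by blast
  then show "\<exists>x\<in>V - A. \<forall>a\<in>A. E x a \<longrightarrow> E y (f a)"
    unfolding complement_def by blast
qed

text \<open>\<open>trans\<close> excludes induced paths on three vertices, so a walk between
  distinct vertices shortens to an edge.\<close>

lemma connected_transitive_complete:
  assumes gr: "graph V E" and con: "connected_graph V E"
    and trans: "\<And>x y z. E x y \<Longrightarrow> E y z \<Longrightarrow> x = z \<or> E x z"
    and "x \<in> V" "y \<in> V" "x \<noteq> y"
  shows "E x y"
proof -
  have "x = v \<or> E x v" if "E\<^sup>*\<^sup>* x v" for v
    using that by induction (use trans in blast)+
  then show ?thesis using assms unfolding connected_graph_def by blast
qed

text \<open>\<open>trans\<close> makes non-adjacency an equivalence relation with classes
  \<open>{y \<in> V. \<not> E x y}\<close>. These are infinite, which yields large independent sets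
  as well as fresh vertices for the back step.\<close>

lemma ME_homogeneous_multipartite:
  assumes gr: "graph V E" and ME: "ME_homogeneous V E" and inf: "infinite V"
    and trans: "\<And>x y z. complement V E x y \<Longrightarrow> complement V E y z \<Longrightarrow> x = z \<or> complement V E x z"
    and ne: "complement V E x0 x1"
    and pairs: "\<And>u v. u \<in> V \<Longrightarrow> v \<in> V \<Longrightarrow> common_nbr V E {u, v}"
  shows "\<And>S. finite S \<Longrightarrow> S \<subseteq> V \<Longrightarrow> common_nbr V E S" "back_property V E"
proof -
  interpret mh_graph V E using ME_homogeneous_mh_graph[OF gr ME] .
  interpret H: mh_graph V "complement V E"
    using ME_homogeneous_mh_graph_complement[OF gr ME] .
  have part: "infinite {y \<in> V. \<not> E x y}" if xV: "x \<in> V" for x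
  proof -
    \<comment> \<open>Extension in the complement moves a non-neighbour of \<open>x0\<close> to one
      of \<open>x\<close>, so no class is a singleton.\<close>
    have "common_nbr V (complement V E) ((\<lambda>_. x) ` {x0})"
    proof (rule H.common_nbr_image)
      show "common_nbr V (complement V E) {x0}"
        using ne unfolding common_nbr_def complement_def using edge_sym by blast
    qed (use xV ne in \<open>auto simp: complement_def\<close>)
    then obtain x' where "complement V E x' x" unfolding common_nbr_def by auto
    moreover obtain z where "E x z"
    proof -
      obtain z where "E z x" using pairs[OF xV xV] unfolding common_nbr_def by blast
      then show thesis using that edge_sym by blast
    qed
    ultimately show ?thesis
      using ME_homogeneous_infinite_nonneighbours[OF gr ME xV, of x' z] edge_sym[of x x']
      unfolding complement_def by blast
  qed
  have indep: "independent E {y \<in> V. \<not> E x y}" if "x \<in> V" for x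
    unfolding independent_def
  proof (intro ballI notI)
    fix y z assume yz: "y \<in> {y \<in> V. \<not> E x y}" "z \<in> {y \<in> V. \<not> E x y}" "E y z"
    then have "y \<noteq> x" "z \<noteq> x" "y \<noteq> z" using edge_sym by auto
    then have "complement V E y x" "complement V E x z"
      using yz that edge_sym unfolding complement_def by auto
    then show False using trans[of y x z] yz \<open>y \<noteq> z\<close> unfolding complement_def by blast
  qed
  obtain x where x: "x \<in> V" using inf by fastforce
  have large: "\<exists>I. I \<subseteq> V \<and> independent E I \<and> finite I \<and> card I = n" for n
  proof -
    obtain I where "finite I" "card I = n" "I \<subseteq> {y \<in> V. \<not> E x y}"
      using infinite_arbitrarily_large[OF part[OF x], of n] by blast
    then show ?thesis using indep[OF x] independent_subset by blast
  qed
  show "common_nbr V E S" if "finite S" "S \<subseteq> V" for S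
    using all_common_nbr pairs large that by blast
  show "back_property V E"
    unfolding back_property_def
  proof (intro allI impI, elim conjE)
    fix A f y
    assume A: "finite A" "A \<subseteq> V" and f: "hom_between E A V f" and y: "y \<in> V" "y \<notin> f ` A"
    have fV: "f a \<in> V" if "a \<in> A" for a using f that unfolding hom_between_def by blast
    show "\<exists>x\<in>V - A. \<forall>a\<in>A. E x a \<longrightarrow> E y (f a)"
    proof (cases "\<forall>a\<in>A. E y (f a)")
      case True
      obtain x where "x \<in> V - A" using inf A(1) by (metis Diff_infinite_finite ex_in_conv finite.emptyI)
      then show ?thesis using True by blast
    next
      case False
      then obtain b where b: "b \<in> A" "\<not> E y (f b)" by blast
      have "infinite ({x \<in> V. \<not> E b x} - A)"
        using part[of b] b A by (simp add: Diff_infinite_finite subset_iff)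
      then have "{x \<in> V. \<not> E b x} - A \<noteq> {}" by (rule infinite_imp_nonempty)
      \<comment> \<open>Since \<open>y\<close> is in the class of \<open>f b\<close>, a fresh
        \<open>x\<close> is taken from the class of \<open>b\<close>. A neighbour \<open>a\<close>
        of \<open>x\<close> is outside that class, hence adjacent to \<open>b\<close>, and so
        \<open>f a\<close> is outside the class of \<open>y\<close>.\<close>
      then obtain x where x: "x \<in> V" "\<not> E b x" "x \<notin> A" by blast
      have "E y (f a)" if a: "a \<in> A" "E x a" for a
      proof (rule ccontr)
        assume "\<not> E y (f a)"
        then have "\<not> E (f a) (f b)"
          using indep[OF y(1)] a b fV unfolding independent_def by blast
        then have "\<not> E a b" using f a b unfolding hom_between_def by blast
        then show False
          using indep[of b] x a b A edge_sym unfolding independent_def by blast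
      qed
      then show ?thesis using x by blast
    qed
  qed
qed

section \<open>Connected ME-homogeneous graphs\<close>

lemma ME_homogeneous_connected:
  assumes gr: "graph V E" and ME: "ME_homogeneous V E" and inf: "infinite V"
    and con: "connected_graph V E"
  shows "\<And>S. finite S \<Longrightarrow> S \<subseteq> V \<Longrightarrow> common_nbr V E S" "back_property V E"
proof -
  let ?H = "complement V E"
  interpret mh_graph V E using ME_homogeneous_mh_graph[OF gr ME] .
  interpret H: mh_graph V ?H using ME_homogeneous_mh_graph_complement[OF gr ME] .
  have ex: "\<exists>x\<in>V. x \<notin> S" if "finite S" for S
    using inf that by (metis finite_subset subsetI)
  have "(\<forall>S. finite S \<and> S \<subseteq> V \<longrightarrow> common_nbr V E S) \<and> back_property V E"
  \<comment> \<open>The condition says that there is no induced path on three vertices; the inner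
    case split asks the same of the complement.\<close>
  proof (cases "\<forall>x y z. E x y \<longrightarrow> E y z \<longrightarrow> x = z \<or> E x z")
    case True
    then have E: "E x y" if "x \<in> V" "y \<in> V" "x \<noteq> y" for x y
      using connected_transitive_complete[OF gr con _ that] by blast
    have "common_nbr V E S" if S: "finite S" "S \<subseteq> V" for S
      using ex[OF S(1)] E S unfolding common_nbr_def by blast
    moreover have "back_property V E"
      unfolding back_property_def
    proof (intro allI impI, elim conjE)
      fix A f y assume "finite A" "hom_between E A V f" "y \<in> V" "y \<notin> f ` A"
      then have "\<forall>a\<in>A. E y (f a)" using E unfolding hom_between_def by blast
      then show "\<exists>x\<in>V - A. \<forall>a\<in>A. E x a \<longrightarrow> E y (f a)" using ex[OF \<open>finite A\<close>] by blast
    qed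
    ultimately show ?thesis by blast
  next
    case False
    then have pairs: "common_nbr V E {u, v}" if "u \<in> V" "v \<in> V" for u v
      using common_nbr_pair that by blast
    from False obtain x0 x1 where "?H x0 x1"
      using edge_in unfolding complement_def by blast
    show ?thesis
    proof (cases "\<forall>x y z. ?H x y \<longrightarrow> ?H y z \<longrightarrow> x = z \<or> ?H x z")
      case True
      then show ?thesis
        using ME_homogeneous_multipartite[OF gr ME inf _ \<open>?H x0 x1\<close> pairs] by blast
    next
      case False
      then have "common_nbr V ?H {u, v}" if "u \<in> V" "v \<in> V" for u v
        using H.common_nbr_pair that by blast
      then have "common_nbr V E S" "common_nbr V ?H S" if "finite S" "S \<subseteq> V" for S
        using common_nbr_both[OF mh_graph_axioms H.mh_graph_axioms inf pairs] that by blast+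
      then show ?thesis using common_nbr_complement_back_property by blast
    qed
  qed
  then show "\<And>S. finite S \<Longrightarrow> S \<subseteq> V \<Longrightarrow> common_nbr V E S" "back_property V E" by blast+
qed

section \<open>Back-and-forth\<close>

text \<open>A partial map as a pair of a domain and a total function, whose values outside the
  domain are irrelevant.\<close>

definition finite_hom :: "'a set \<Rightarrow> ('a \<Rightarrow> 'a \<Rightarrow> bool) \<Rightarrow> 'a set \<times> ('a \<Rightarrow> 'a) \<Rightarrow> bool" where
  "finite_hom V E F \<longleftrightarrow> finite (fst F) \<and> fst F \<subseteq> V \<and> hom_between E (fst F) V (snd F)"

text \<open>Injectivity is kept only if present at the start, so that one construction serves both
  homomorphisms and monomorphisms.\<close>

definition hom_extends :: "'a set \<times> ('a \<Rightarrow> 'a) \<Rightarrow> 'a set \<times> ('a \<Rightarrow> 'a) \<Rightarrow> bool" where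
  "hom_extends F G \<longleftrightarrow> fst F \<subseteq> fst G \<and> (\<forall>x\<in>fst F. snd G x = snd F x) \<and>
     (inj_on (snd F) (fst F) \<longrightarrow> inj_on (snd G) (fst G))"

lemma hom_extends_trans: "hom_extends F G \<Longrightarrow> hom_extends G H \<Longrightarrow> hom_extends F H"
  unfolding hom_extends_def by (elim conjE, intro conjI ballI) (auto dest: subsetD)

lemma finite_hom_add:
  assumes gr: "graph V E" and F: "finite_hom V E (A, f)" and x: "x \<in> V" "x \<notin> A"
    and y: "y \<in> V" "y \<notin> f ` A" "\<And>a. a \<in> A \<Longrightarrow> E x a \<Longrightarrow> E y (f a)"
  shows "finite_hom V E (insert x A, f(x := y))"
    and "hom_extends (A, f) (insert x A, f(x := y))"
proof -
  have E: "\<And>u v. E u v \<Longrightarrow> E v u" "\<And>u. \<not> E u u" using gr unfolding graph_def by blast+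
  have im: "(f(x := y)) ` A = f ` A" using x by (intro image_cong) auto
  have inj: "inj_on (f(x := y)) A = inj_on f A" using x by (intro inj_on_cong) auto
  have hom: "f ` A \<subseteq> V" "\<forall>a\<in>A. \<forall>b\<in>A. E a b \<longrightarrow> E (f a) (f b)"
    using F unfolding finite_hom_def hom_between_def by auto
  have "E ((f(x := y)) a) ((f(x := y)) b)" if "a \<in> insert x A" "b \<in> insert x A" "E a b" for a b
    using that hom(2) E y(3) x by (auto simp: fun_upd_def)
  then show "finite_hom V E (insert x A, f(x := y))"
    using F x y im hom(1) unfolding finite_hom_def hom_between_def by simp
  show "hom_extends (A, f) (insert x A, f(x := y))"
    using x y im inj unfolding hom_extends_def by (auto simp: inj_on_insert)
qed

text \<open>Forth: \<open>v\<close> goes to a common neighbour of the image, which is outside the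
  image as there are no loops, so injectivity survives. Back: \<open>back_property\<close> supplies
  a preimage of \<open>v\<close>.\<close>

lemma finite_hom_step:
  assumes gr: "graph V E" and forth: "\<And>S. finite S \<Longrightarrow> S \<subseteq> V \<Longrightarrow> common_nbr V E S"
    and bp: "back_property V E" and F: "finite_hom V E F" and v: "v \<in> V"
  shows "\<exists>G. finite_hom V E G \<and> hom_extends F G \<and> v \<in> fst G \<and> v \<in> snd G ` fst G"
proof -
  obtain G where G: "finite_hom V E G" "hom_extends F G" "v \<in> fst G"
  proof (cases "v \<in> fst F")
    case True
    then show thesis using that[of F] F unfolding hom_extends_def by blast
  next
    case False
    have fin: "finite (snd F ` fst F)" "snd F ` fst F \<subseteq> V"
      using F unfolding finite_hom_def hom_between_def by auto
    obtain y where "y \<in> V" "\<forall>s\<in>snd F ` fst F. E y s"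
      using forth[OF fin] unfolding common_nbr_def by blast
    moreover from this have "y \<notin> snd F ` fst F" using gr unfolding graph_def by blast
    ultimately show thesis
      using finite_hom_add[OF gr, of "fst F" "snd F" v y] F v False
      by (intro that[of "(insert v (fst F), (snd F)(v := y))"]) auto
  qed
  show ?thesis
  proof (cases "v \<in> snd G ` fst G")
    case True
    then show ?thesis using G by blast
  next
    case False
    obtain x where x: "x \<in> V" "x \<notin> fst G" "\<forall>a\<in>fst G. E x a \<longrightarrow> E v (snd G a)"
      using bp[unfolded back_property_def, rule_format, of "fst G" "snd G" v] G v False
      unfolding finite_hom_def by blast
    let ?G = "(insert x (fst G), (snd G)(x := v))"
    have "finite_hom V E ?G" "hom_extends G ?G"
      using finite_hom_add[OF gr, of "fst G" "snd G" x v] G x v False by auto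
    moreover have "v \<in> fst ?G" "v \<in> snd ?G ` fst ?G" using G by auto
    ultimately show ?thesis using G hom_extends_trans by blast
  qed
qed

lemma back_and_forth:
  assumes gr: "graph V E" and cnt: "countable V" and ne: "V \<noteq> {}"
    and forth: "\<And>S. finite S \<Longrightarrow> S \<subseteq> V \<Longrightarrow> common_nbr V E S"
    and bp: "back_property V E"
    and A: "finite A" "A \<subseteq> V" "hom_between E A V f"
  obtains g where "surj_endomorphism V E g" "\<And>x. x \<in> A \<Longrightarrow> g x = f x"
    "inj_on f A \<Longrightarrow> inj_on g V"
proof -
  define v where "v = from_nat_into V"
  have v: "v n \<in> V" for n using ne unfolding v_def by (rule from_nat_into)
  have vsurj: "\<exists>n. v n = x" if "x \<in> V" for x
    using that cnt unfolding v_def by (metis from_nat_into_surj)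
  \<comment> \<open>Stage \<open>n\<close> puts the \<open>n\<close>-th vertex of the enumeration
    into both domain and image.\<close>
  define Q where "Q n F G \<longleftrightarrow> hom_extends F G \<and> v n \<in> fst G \<and> v n \<in> snd G ` fst G"
    for n and F G :: "'a set \<times> ('a \<Rightarrow> 'a)"
  define P where "P n F \<longleftrightarrow> finite_hom V E F \<and> hom_extends (A, f) F"
    for n :: nat and F :: "'a set \<times> ('a \<Rightarrow> 'a)"
  have "\<exists>F. \<forall>n. P n (F n) \<and> Q n (F n) (F (Suc n))"
  proof (rule dependent_nat_choice)
    have "P 0 (A, f)" using A unfolding P_def finite_hom_def hom_extends_def by auto
    then show "\<exists>F. P 0 F" by blast
    show "\<exists>G. P (Suc n) G \<and> Q n F G" if "P n F" for n F
      using finite_hom_step[OF gr forth bp, of F "v n"] that v hom_extends_trans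
      unfolding P_def Q_def by blast
  qed
  then obtain F where F: "\<And>n. finite_hom V E (F n)" "\<And>n. hom_extends (A, f) (F n)"
    "\<And>n. hom_extends (F n) (F (Suc n))" "\<And>n. v n \<in> fst (F (Suc n))"
    "\<And>n. v n \<in> snd (F (Suc n)) ` fst (F (Suc n))"
    unfolding P_def Q_def by blast
  have mono: "hom_extends (F m) (F n)" if "m \<le> n" for m n
    using that
  proof (induction rule: dec_induct)
    case base
    show ?case unfolding hom_extends_def by blast
  next
    case (step n)
    then show ?case using F(3) hom_extends_trans by blast
  qed
  \<comment> \<open>\<open>g\<close> is the union of the chain: its value at \<open>x\<close> is
    read off at the first stage defined at \<open>x\<close> and, by \<open>mono\<close>, never
    changes later.\<close>
  define k where "k x = (LEAST n. x \<in> fst (F n))" for x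
  define g where "g x = snd (F (k x)) x" for x
  have dom: "\<exists>n. x \<in> fst (F n)" if "x \<in> V" for x using vsurj[OF that] F(4) by metis
  have g: "g x = snd (F n) x" if "x \<in> fst (F n)" for x n
  proof -
    have "x \<in> fst (F (k x))" "k x \<le> n"
      using that unfolding k_def by (auto intro: LeastI Least_le)
    then show ?thesis using mono[of "k x" n] unfolding g_def hom_extends_def by auto
  qed
  have dom2: "\<exists>n. x \<in> fst (F n) \<and> y \<in> fst (F n)" if xy: "x \<in> V" "y \<in> V" for x y
  proof -
    obtain m n where mn: "x \<in> fst (F m)" "y \<in> fst (F n)" using dom xy by blast
    have "x \<in> fst (F (max m n))" "y \<in> fst (F (max m n))"
      using mn mono[of m "max m n"] mono[of n "max m n"] unfolding hom_extends_def by auto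
    then show ?thesis by blast
  qed
  have Fin: "snd (F n) x \<in> V" if "x \<in> fst (F n)" for n x
    using F(1)[of n] that unfolding finite_hom_def hom_between_def by blast
  have FE: "E (snd (F n) x) (snd (F n) y)" if "x \<in> fst (F n)" "y \<in> fst (F n)" "E x y" for n x y
    using F(1)[of n] that unfolding finite_hom_def hom_between_def by blast
  have gV: "g x \<in> V" if "x \<in> V" for x using dom[OF that] g Fin by metis
  have gE: "E (g x) (g y)" if "x \<in> V" "y \<in> V" "E x y" for x y
    using dom2[OF that(1,2)] g FE that(3) by metis
  have gs: "\<exists>x\<in>V. g x = y" if yV: "y \<in> V" for y
  proof -
    obtain n where n: "v n = y" using vsurj[OF yV] by blast
    then obtain x where x: "x \<in> fst (F (Suc n))" "snd (F (Suc n)) x = y"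
      using F(5)[of n] by auto
    then have "x \<in> V" using F(1)[of "Suc n"] unfolding finite_hom_def by blast
    then show ?thesis using g x by metis
  qed
  show thesis
  proof
    show "surj_endomorphism V E g"
      using gV gE gs unfolding surj_endomorphism_def endomorphism_def hom_between_def by blast
    show "g x = f x" if "x \<in> A" for x
      using F(2)[of 0] that g[of x 0] unfolding hom_extends_def by auto
    assume inj: "inj_on f A"
    have injF: "inj_on (snd (F n)) (fst (F n))" for n
      using F(2)[of n] inj unfolding hom_extends_def by auto
    show "inj_on g V"
    proof (rule inj_onI)
      fix x y assume xy: "x \<in> V" "y \<in> V" "g x = g y"
      obtain n where n: "x \<in> fst (F n)" "y \<in> fst (F n)" using dom2 xy by blast
      then show "x = y" using xy(3) injF[of n] g by (metis inj_onD)
    qed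
  qed
qed

theorem theorem8p2:
  fixes V :: "'a set" and E :: "'a \<Rightarrow> 'a \<Rightarrow> bool"
  assumes "graph V E" and "countable V" and "infinite V" and "connected_graph V E"
  shows "(HE_homogeneous V E \<longleftrightarrow> ME_homogeneous V E) \<and>
         (ME_homogeneous V E \<longleftrightarrow> MB_homogeneous V E)"
proof -
  have "HE_homogeneous V E \<Longrightarrow> ME_homogeneous V E"
    unfolding HE_homogeneous_def ME_homogeneous_def mono_between_def by blast
  moreover have "surj_endomorphism V E g" if "bimorphism V E g" for g
    using that unfolding bimorphism_def surj_endomorphism_def bij_betw_def by simp
  then have "MB_homogeneous V E \<Longrightarrow> ME_homogeneous V E"
    unfolding MB_homogeneous_def ME_homogeneous_def by metis
  moreover have "HE_homogeneous V E \<and> MB_homogeneous V E" if ME: "ME_homogeneous V E"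
  proof -
    have "V \<noteq> {}" using assms(3) by auto
    \<comment> \<open>The extension obtained is surjective in any case and injective whenever
      \<open>f\<close> is, which serves HE- and MB-homogeneity alike.\<close>
    note extension = back_and_forth[OF assms(1,2) this
        ME_homogeneous_connected[OF assms(1) ME assms(3,4)]]
    have hom: "hom_between E A V f" if "hom_between E A B f" "B \<subseteq> V" for A B f
      using that unfolding hom_between_def by blast
    have "HE_homogeneous V E"
      unfolding HE_homogeneous_def
    proof (intro allI impI, elim conjE)
      fix A B f assume "A \<subseteq> V" "B \<subseteq> V" "finite A" "hom_between E A B f"
      then show "\<exists>g. surj_endomorphism V E g \<and> (\<forall>x\<in>A. g x = f x)"
        using extension hom by metis
    qed
    moreover have "MB_homogeneous V E"
      unfolding MB_homogeneous_def
    proof (intro allI impI, elim conjE)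
      fix A B f assume "A \<subseteq> V" "B \<subseteq> V" "finite A" and f: "mono_between E A B f"
      then obtain g where "surj_endomorphism V E g" "\<And>x. x \<in> A \<Longrightarrow> g x = f x" "inj_on g V"
        using extension hom unfolding mono_between_def by metis
      then show "\<exists>g. bimorphism V E g \<and> (\<forall>x\<in>A. g x = f x)"
        unfolding bimorphism_def surj_endomorphism_def bij_betw_def by blast
    qed
    ultimately show ?thesis by blast
  qed
  ultimately show ?thesis by blast
qed

end
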